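(* For each $K<3/2$ there exists a weight $\boldsymbol{w}$ such that $\boldsymbol{K}_{\boldsymbol{w}}\ge K$, where $\boldsymbol{K}_{\boldsymbol{w}}$ is the suppression unconditionality constant of the unit vector system of $\boldsymbol{D}_{\boldsymbol{w}}$.
   Context: $\mathbb{F}=\mathbb{R}$ or $\mathbb{C}$; $c_{00}$ is the space of finitely supported sequences in $\mathbb{F}^{\mathbb{N}}$; $(\boldsymbol{e}_j)$ is the unit vector system. A weight is a nonincreasing sequence $\boldsymbol{w}=(w_j)_{j=1}^\infty$ of positive scalars with $w_1=1$; $s_n=\sum_{j=1}^n w_j$, $s_0=0$. For finite $E\subset\mathbb{N}$ (possibly empty) with $|E|=n$, $\Pi(E)$ is the set of all bijections from $\{j\in\mathbb{N}:j>n\}$ onto $\mathbb{N}\setminus E$. For $f=(a_j)\in c_{00}$, $\mathbf{\Phi}_1(E;f)=\frac{s_n}{n}\sum_{j\in E}|a_j|$ (with $\mathbf{\Phi}_1(\emptyset;f)=0$), $\mathbf{\Phi}_2(E;f)=\sup_{\varphi\in\Pi(E)}\left|\sum_{j=n+1}^\infty a_{\varphi(j)}w_j\right|$, $\mathbf{\Phi}=\mathbf{\Phi}_1+\mathbf{\Phi}_2$, and $\|f\|_{\boldsymbol{D},\boldsymbol{w}}=\sup\{\mathbf{\Phi}(E;f):E\subset\mathbb{N},|E|<\infty\}$. This is a norm on $c_{00}$, and $\boldsymbol{D}_{\boldsymbol{w}}$ is the completion of $(c_{00},\|\cdot\|_{\boldsymbol{D},\boldsymbol{w}})$. $\boldsymbol{K}_{\boldsymbol{w}}$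 is the smallest constant $K$ such that $\|S_A(x)\|\le K\|x\|$ for all finite $A\subset\mathbb{N}$ and all $x\in\boldsymbol{D}_{\boldsymbol{w}}$, where $S_A$ is the coordinate projection onto $A$ ($S_A(f)=f\chi_A$ for $f\in c_{00}$). *)

theory Defs
  imports "HOL-Analysis.Analysis"
begin

text \<open>
  Sequences are indexed from 0, so the mathematical index \<open>j \<ge> 1\<close> becomes \<open>j - 1\<close>;
  in particular \<open>{j. j > n}\<close> becomes \<open>{n..}\<close>. The scalar field is a type of class
  \<open>real_normed_field\<close>, to be instantiated with \<open>real\<close> or \<open>complex\<close>.
\<close>

definition c00 :: "(nat \<Rightarrow> 'a::real_normed_field) set" where
  "c00 = {f. finite {j. f j \<noteq> 0}}"

definition weight :: "(nat \<Rightarrow> real) \<Rightarrow> bool" where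
  "weight w \<longleftrightarrow> (\<forall>j. 0 < w j) \<and> antimono w \<and> w 0 = 1"

definition wsum :: "(nat \<Rightarrow> real) \<Rightarrow> nat \<Rightarrow> real" where
  "wsum w n = (\<Sum>j<n. w j)"

text \<open>Values of \<open>\<phi>\<close> below \<open>card E\<close> are unconstrained, and are never used.\<close>

definition tail_bij :: "nat set \<Rightarrow> (nat \<Rightarrow> nat) set" where
  "tail_bij E = {\<phi>. bij_betw \<phi> {card E..} (- E)}"

text \<open>For \<open>E = {}\<close> the value is 0.\<close>

definition Phi1 :: "(nat \<Rightarrow> real) \<Rightarrow> nat set \<Rightarrow> (nat \<Rightarrow> 'a::real_normed_field) \<Rightarrow> real" where
  "Phi1 w E f = wsum w (card E) / real (card E) * (\<Sum>j\<in>E. norm (f j))"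

text \<open>
  For a weight \<open>w\<close> and \<open>f \<in> c00\<close>, the infinite sum has only finitely many nonzero terms, and both
  suprema below are over nonempty sets bounded above by \<open>\<Sum>j. norm (f j)\<close>.
\<close>

definition Phi2 :: "(nat \<Rightarrow> real) \<Rightarrow> nat set \<Rightarrow> (nat \<Rightarrow> 'a::real_normed_field) \<Rightarrow> real" where
  "Phi2 w E f =
     (SUP \<phi>\<in>tail_bij E. norm (\<Sum>\<^sub>\<infinity>j\<in>{card E..}. f (\<phi> j) * of_real (w j)))"

definition Phi :: "(nat \<Rightarrow> real) \<Rightarrow> nat set \<Rightarrow> (nat \<Rightarrow> 'a::real_normed_field) \<Rightarrow> real" where
  "Phi w E f = Phi1 w E f + Phi2 w E f"

definition normD :: "(nat \<Rightarrow> real) \<Rightarrow> (nat \<Rightarrow> 'a::real_normed_field) \<Rightarrow> real" where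
  "normD w f = (SUP E\<in>{E. finite E}. Phi w E f)"

definition proj :: "nat set \<Rightarrow> (nat \<Rightarrow> 'a) \<Rightarrow> (nat \<Rightarrow> 'a::real_normed_field)" where
  "proj A f = (\<lambda>j. if j \<in> A then f j else 0)"

text \<open>
  The completion of \<open>c00\<close> under \<open>normD w\<close>: Cauchy sequences in \<open>c00\<close>
  modulo sequences tending to 0 in norm.
\<close>

definition D_Cauchy :: "(nat \<Rightarrow> real) \<Rightarrow> (nat \<Rightarrow> nat \<Rightarrow> 'a::real_normed_field) set" where
  "D_Cauchy w = {u. (\<forall>k. u k \<in> c00) \<and>
     (\<forall>\<epsilon>>0. \<exists>N. \<forall>k\<ge>N. \<forall>l\<ge>N. normD w (\<lambda>j. u k j - u l j) < \<epsilon>)}"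

definition D_rel ::
  "(nat \<Rightarrow> real) \<Rightarrow> ((nat \<Rightarrow> nat \<Rightarrow> 'a::real_normed_field) \<times> (nat \<Rightarrow> nat \<Rightarrow> 'a)) set" where
  "D_rel w = {(u, v). u \<in> D_Cauchy w \<and> v \<in> D_Cauchy w \<and>
     (\<lambda>k. normD w (\<lambda>j. u k j - v k j)) \<longlonglongrightarrow> 0}"

definition D_space :: "(nat \<Rightarrow> real) \<Rightarrow> (nat \<Rightarrow> nat \<Rightarrow> 'a::real_normed_field) set set" where
  "D_space w = D_Cauchy w // D_rel w"

definition D_norm :: "(nat \<Rightarrow> real) \<Rightarrow> (nat \<Rightarrow> nat \<Rightarrow> 'a::real_normed_field) set \<Rightarrow> real" where
  "D_norm w x = (THE r. \<forall>u\<in>x. (\<lambda>k. normD w (u k)) \<longlonglongrightarrow> r)"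

text \<open>
  The continuous extension of \<open>proj A\<close> to the completion; \<open>proj A\<close> is bounded on \<open>c00\<close> for
  finite \<open>A\<close>, so the result does not depend on the representative \<open>u\<close>.
\<close>

definition D_proj :: "(nat \<Rightarrow> real) \<Rightarrow> nat set \<Rightarrow>
    (nat \<Rightarrow> nat \<Rightarrow> 'a::real_normed_field) set \<Rightarrow> (nat \<Rightarrow> nat \<Rightarrow> 'a) set" where
  "D_proj w A x = (\<Union>u\<in>x. D_rel w `` {\<lambda>k. proj A (u k)})"

definition suppression_const :: "'a::real_normed_field itself \<Rightarrow> (nat \<Rightarrow> real) \<Rightarrow> real" where
  "suppression_const _ w =
     (LEAST K. \<forall>A. finite A \<longrightarrow>
        (\<forall>x \<in> (D_space w :: (nat \<Rightarrow> nat \<Rightarrow> 'a) set set).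
           D_norm w (D_proj w A x) \<le> K * D_norm w x))"

end

theory Submission
  imports Defs
begin

text \<open>
  A single weight serves every \<open>K\<close>. It equals \<open>1 / \<surd>j\<close> at the first \<open>N\<close> places and the constant
  \<open>c = 1 / \<surd>N\<close> from there on. That the weight does not tend to \<open>0\<close> is essential: negative entries
  that are moved far out still cost a fixed fraction of their mass, so that signs can cancel.

  Let \<open>H\<close> be the \<open>N\<close>-th harmonic number. The vector has the entries \<open>1 / \<surd>j\<close> on a set \<open>A\<close> of
  size \<open>N\<close> and, on a set \<open>B\<close> of size far larger than \<open>N\<close>, tiny equal negative entries of total mass
  \<open>H / (2 c)\<close>. Its projection to \<open>A\<close> has norm at least \<open>\<Sum>j\<le>N. (1 / \<surd>j)\<^sup>2 = H\<close>. For the whole vector,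
  let \<open>E\<close> contain a proportion \<open>\<beta>\<close> of \<open>B\<close>. Up to bounded errors the following holds.
  \<^item> The averaged term \<open>\<Phi>\<^sub>1\<close> is \<open>\<beta> H / 2\<close>: the entries on \<open>A\<close> contribute \<open>O(1)\<close> to it, because
    the first \<open>n\<close> weights average to \<open>O(1 / \<surd>m)\<close>, where \<open>m\<close> is the minimum of \<open>n\<close> and \<open>N\<close>, and at
    most \<open>n\<close> entries on \<open>A\<close> sum to \<open>O(\<surd>m)\<close>.
  \<^item> In \<open>\<Phi>\<^sub>2\<close>, the negative entries give \<open>(1 - \<beta>) H / 2\<close> under every arrangement, because only \<open>N\<close>
    of them can meet a weight above \<open>c\<close>.
  \<^item> The positive entries give between \<open>0\<close> and \<open>H\<close>; but as soon as \<open>E\<close> has \<open>N\<close> elements, all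
    weights left are equal to \<open>c\<close> and they give \<open>O(1)\<close>.
  So either \<open>\<beta>\<close> is negligible, and the value is at most \<open>H - H / 2\<close>, or the positive entries are
  negligible, and the value is about \<open>\<beta> H / 2 + (1 - \<beta>) H / 2\<close>. In each case the norm is at most
  \<open>7 + H / 2\<close> (\<open>Phi_arrangement_x_le\<close>), and the quotient of norms reaches \<open>3 / 2\<close> once \<open>H \<ge> 42\<close>.

  The transfer to the completion uses that a weight bounded below by \<open>c > 0\<close> makes the norm
  equivalent to the \<open>\<ell>\<^sub>1\<close> norm. Hence the coordinate projections are uniformly bounded, and a least
  constant exists (\<open>suppression_const_ge\<close>).
\<close>

section \<open>The norm in terms of arrangements\<close>

lemma c00_if_support:
  assumes "f \<in> c00" "g \<in> c00" "\<And>j. f j = 0 \<Longrightarrow> g j = 0 \<Longrightarrow> h j = 0"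
  shows "h \<in> c00"
  unfolding c00_def
proof
  show "finite {j. h j \<noteq> 0}"
    by (rule finite_subset[of _ "{j. f j \<noteq> 0} \<union> {j. g j \<noteq> 0}"])
       (use assms in \<open>auto simp: c00_def\<close>)
qed

lemma c00_zero [simp]: "(\<lambda>_. 0) \<in> c00"
  by (simp add: c00_def)

lemma c00_diff [simp]: "f \<in> c00 \<Longrightarrow> g \<in> c00 \<Longrightarrow> (\<lambda>j. f j - g j) \<in> c00"
  by (rule c00_if_support[of f g]) auto

lemma c00_proj [simp]: "f \<in> c00 \<Longrightarrow> proj A f \<in> c00"
  by (rule c00_if_support[of f f]) (auto simp: proj_def)

definition l1 :: "(nat \<Rightarrow> 'a::real_normed_field) \<Rightarrow> real" where
  "l1 f = (\<Sum>j | f j \<noteq> 0. norm (f j))"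

lemma l1_eq_sum: "finite F \<Longrightarrow> {j. f j \<noteq> 0} \<subseteq> F \<Longrightarrow> l1 f = (\<Sum>j\<in>F. norm (f j))"
  unfolding l1_def by (rule sum.mono_neutral_left) auto

lemma l1_proj_le:
  assumes "f \<in> c00"
  shows "l1 (proj A f) \<le> l1 f"
proof -
  have "l1 (proj A f) = (\<Sum>j | f j \<noteq> 0. norm (proj A f j))"
    by (rule l1_eq_sum) (use assms in \<open>auto simp: c00_def proj_def\<close>)
  also have "\<dots> \<le> l1 f"
    unfolding l1_def by (rule sum_mono) (simp add: proj_def)
  finally show ?thesis .
qed

definition tail_sum ::
  "(nat \<Rightarrow> real) \<Rightarrow> nat set \<Rightarrow> (nat \<Rightarrow> nat) \<Rightarrow> (nat \<Rightarrow> 'a::real_normed_field) \<Rightarrow> 'a" where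
  "tail_sum w E \<phi> f = (\<Sum>\<^sub>\<infinity>j\<in>{card E..}. f (\<phi> j) * of_real (w j))"

abbreviation position :: "nat set \<Rightarrow> (nat \<Rightarrow> nat) \<Rightarrow> nat \<Rightarrow> nat" where
  "position E \<phi> \<equiv> inv_into {card E..} \<phi>"

lemma inj_on_position: "\<phi> \<in> tail_bij E \<Longrightarrow> inj_on (position E \<phi>) (- E)"
  unfolding tail_bij_def using bij_betw_inv_into[of \<phi> "{card E..}" "- E"]
  by (auto simp: bij_betw_def)

lemma position_ge: "\<phi> \<in> tail_bij E \<Longrightarrow> i \<notin> E \<Longrightarrow> card E \<le> position E \<phi> i"
  unfolding tail_bij_def using bij_betw_inv_into[of \<phi> "{card E..}" "- E"]
  by (auto simp: bij_betw_def)

text \<open>Summing over the entries instead of over the positions makes the dependence on the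
  sequence linear with a fixed finite index set.\<close>

lemma tail_sum_eq:
  assumes \<phi>: "\<phi> \<in> tail_bij E" and F: "finite F" "{j. f j \<noteq> 0} \<subseteq> F"
  shows "tail_sum w E \<phi> f = (\<Sum>i\<in>F - E. f i * of_real (w (position E \<phi> i)))"
proof -
  have bij: "bij_betw \<phi> {card E..} (- E)" using \<phi> by (simp add: tail_bij_def)
  have "tail_sum w E \<phi> f =
      (\<Sum>\<^sub>\<infinity>j\<in>{card E..}. f (\<phi> j) * of_real (w (position E \<phi> (\<phi> j))))"
    unfolding tail_sum_def
    by (rule infsum_cong) (use bij in \<open>auto simp: bij_betw_def\<close>)
  also have "\<dots> = (\<Sum>\<^sub>\<infinity>i\<in>- E. f i * of_real (w (position E \<phi> i)))"
    by (rule infsum_reindex_bij_betw[OF bij])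
  also have "\<dots> = (\<Sum>\<^sub>\<infinity>i\<in>F - E. f i * of_real (w (position E \<phi> i)))"
    by (rule infsum_cong_neutral) (use F in auto)
  also have "\<dots> = (\<Sum>i\<in>F - E. f i * of_real (w (position E \<phi> i)))"
    using F by (simp add: infsum_finite)
  finally show ?thesis .
qed

lemma tail_sum_add:
  assumes "\<phi> \<in> tail_bij E" "f \<in> c00" "g \<in> c00"
  shows "tail_sum w E \<phi> (\<lambda>j. f j + g j) = tail_sum w E \<phi> f + tail_sum w E \<phi> g"
proof -
  let ?F = "{j. f j \<noteq> 0} \<union> {j. g j \<noteq> 0}"
  have F: "finite ?F" using assms by (auto simp: c00_def)
  show ?thesis
    by (subst (1 2 3) tail_sum_eq[OF assms(1) F]) (auto simp: algebra_simps sum.distrib)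
qed

lemma tail_bij_nonempty:
  assumes "finite E"
  shows "tail_bij E \<noteq> {}"
proof -
  have "infinite (- E)" using assms by (simp add: Compl_eq_Diff_UNIV)
  hence "bij_betw (enumerate (- E)) UNIV (- E)" by (rule bij_enumerate)
  moreover have "bij_betw (\<lambda>j. j - card E) {card E..} UNIV"
    by (rule bij_betw_byWitness[where f' = "\<lambda>j. j + card E"]) auto
  ultimately have "bij_betw (enumerate (- E) \<circ> (\<lambda>j. j - card E)) {card E..} (- E)"
    by (rule bij_betw_trans[rotated])
  thus ?thesis by (auto simp: tail_bij_def)
qed

lemma weight_pos: "weight w \<Longrightarrow> 0 < w j"
  by (simp add: weight_def)

lemma weight_le_1: "weight w \<Longrightarrow> w j \<le> 1"
  unfolding weight_def by (metis antimonoD le0)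

lemma wsum_nonneg: "weight w \<Longrightarrow> 0 \<le> wsum w n"
  unfolding wsum_def by (intro sum_nonneg) (simp add: weight_pos less_imp_le)

lemma wsum_le: "weight w \<Longrightarrow> wsum w n \<le> real n"
  unfolding wsum_def using sum_bounded_above[of "{..<n}" w 1] by (simp add: weight_le_1)

lemma Phi1_nonneg: "weight w \<Longrightarrow> 0 \<le> Phi1 w E f"
  unfolding Phi1_def by (simp add: sum_nonneg wsum_nonneg)

lemma Phi1_le: 
  assumes "weight w"
  shows "Phi1 w E f \<le> (\<Sum>j\<in>E. norm (f j))"
proof -
  have "wsum w (card E) / real (card E) \<le> 1"
    using wsum_le[OF assms, of "card E"] by (cases "card E = 0") (simp_all add: divide_le_eq_1)
  thus ?thesis unfolding Phi1_def
    using mult_right_mono[of _ 1 "\<Sum>j\<in>E. norm (f j)"] sum_nonneg[of E "\<lambda>j. norm (f j)"] by force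
qed

lemma Phi1_add_le:
  assumes "weight w"
  shows "Phi1 w E (\<lambda>j. f j + g j) \<le> Phi1 w E f + Phi1 w E g"
proof -
  have "(\<Sum>j\<in>E. norm (f j + g j)) \<le> (\<Sum>j\<in>E. norm (f j)) + (\<Sum>j\<in>E. norm (g j))"
    by (simp add: norm_triangle_ineq sum_mono flip: sum.distrib)
  hence "wsum w (card E) / real (card E) * (\<Sum>j\<in>E. norm (f j + g j)) \<le>
      wsum w (card E) / real (card E) * ((\<Sum>j\<in>E. norm (f j)) + (\<Sum>j\<in>E. norm (g j)))"
    by (rule mult_left_mono) (simp add: wsum_nonneg assms)
  thus ?thesis unfolding Phi1_def by (simp add: algebra_simps)
qed

lemma Phi_arrangement_le_l1:
  assumes "weight w" "f \<in> c00" "finite E" "\<phi> \<in> tail_bij E"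
  shows "Phi1 w E f + norm (tail_sum w E \<phi> f) \<le> l1 f"
proof -
  let ?F = "{j. f j \<noteq> 0}"
  have F: "finite ?F" using assms by (simp add: c00_def)
  have "norm (tail_sum w E \<phi> f) \<le>
      (\<Sum>i\<in>?F - E. norm (f i * of_real (w (position E \<phi> i))))"
    unfolding tail_sum_eq[OF assms(4) F order_refl] by (rule norm_sum)
  also have "\<dots> \<le> (\<Sum>i\<in>?F - E. norm (f i))"
    by (rule sum_mono)
       (simp add: norm_mult mult_left_le weight_le_1[OF assms(1)]
          less_imp_le[OF weight_pos[OF assms(1)]])
  finally have 2: "norm (tail_sum w E \<phi> f) \<le> (\<Sum>i\<in>?F - E. norm (f i))" .
  have "Phi1 w E f \<le> (\<Sum>j\<in>E. norm (f j))" by (rule Phi1_le) fact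
  also have "\<dots> = (\<Sum>j\<in>?F \<inter> E. norm (f j))"
    by (rule sum.mono_neutral_right) (use assms in auto)
  finally have "Phi1 w E f \<le> (\<Sum>j\<in>?F \<inter> E. norm (f j))" .
  moreover have "l1 f = (\<Sum>j\<in>?F \<inter> E. norm (f j)) + (\<Sum>j\<in>?F - E. norm (f j))"
    unfolding l1_def by (rule sum.Int_Diff[OF F])
  ultimately show ?thesis using 2 by linarith
qed

text \<open>Together with \<open>Phi_arrangement_le_normD\<close>, this flattens the two nested suprema: the norm is the
  least upper bound over all pairs of a finite set and an arrangement of its complement.\<close>

lemma normD_le:
  assumes "\<And>E \<phi>. finite E \<Longrightarrow> \<phi> \<in> tail_bij E \<Longrightarrow> Phi1 w E f + norm (tail_sum w E \<phi> f) \<le> r"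
  shows "normD w f \<le> r"
  unfolding normD_def
proof (rule cSUP_least)
  fix E :: "nat set" assume "E \<in> {E. finite E}"
  hence E: "finite E" by simp
  have "Phi2 w E f \<le> r - Phi1 w E f"
    unfolding Phi2_def
  proof (rule cSUP_least[OF tail_bij_nonempty[OF E]])
    fix \<phi> assume "\<phi> \<in> tail_bij E"
    from assms[OF E this]
    show "norm (\<Sum>\<^sub>\<infinity>j\<in>{card E..}. f (\<phi> j) * of_real (w j)) \<le> r - Phi1 w E f"
      by (simp add: tail_sum_def)
  qed
  thus "Phi w E f \<le> r" by (simp add: Phi_def)
qed auto

lemma Phi_arrangement_le_normD:
  assumes w: "weight w" and f: "f \<in> c00" and E: "finite E" and \<phi>: "\<phi> \<in> tail_bij E"
  shows "Phi1 w E f + norm (tail_sum w E \<phi> f) \<le> normD w f"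
proof -
  have le: "norm (\<Sum>\<^sub>\<infinity>j\<in>{card E'..}. f (\<phi>' j) * of_real (w j)) \<le> l1 f - Phi1 w E' f"
    if "finite E'" "\<phi>' \<in> tail_bij E'" for E' \<phi>'
    using Phi_arrangement_le_l1[OF w f that] by (simp add: tail_sum_def)
  have "norm (tail_sum w E \<phi> f) \<le> Phi2 w E f"
    unfolding Phi2_def tail_sum_def by (rule cSUP_upper[OF \<phi>]) (use le E in \<open>force intro: bdd_aboveI2\<close>)
  hence "Phi1 w E f + norm (tail_sum w E \<phi> f) \<le> Phi w E f" by (simp add: Phi_def)
  also have "\<dots> \<le> normD w f"
    unfolding normD_def
  proof (rule cSUP_upper)
    show "bdd_above ((\<lambda>E. Phi w E f) ` {E. finite E})"
    proof (rule bdd_aboveI2)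
      fix E' :: "nat set" assume "E' \<in> {E. finite E}"
      hence E': "finite E'" by simp
      have "Phi2 w E' f \<le> l1 f - Phi1 w E' f"
        unfolding Phi2_def by (rule cSUP_least[OF tail_bij_nonempty[OF E']]) (rule le[OF E'])
      thus "Phi w E' f \<le> l1 f" by (simp add: Phi_def)
    qed
  qed (use E in simp)
  finally show ?thesis .
qed

lemma normD_le_l1: "weight w \<Longrightarrow> f \<in> c00 \<Longrightarrow> normD w f \<le> l1 f"
  by (rule normD_le) (rule Phi_arrangement_le_l1)

lemma normD_nonneg:
  assumes "weight w" "f \<in> c00"
  shows "0 \<le> normD w f"
proof -
  obtain \<phi> where "\<phi> \<in> tail_bij {}" using tail_bij_nonempty[of "{}"] by auto
  from Phi_arrangement_le_normD[OF assms _ this] Phi1_nonneg[OF assms(1), of "{}" f]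
  show ?thesis by (smt (verit) finite.emptyI norm_ge_zero)
qed

lemma normD_zero [simp]: "normD w (\<lambda>_. 0 :: 'a::real_normed_field) = 0"
proof -
  have "Phi2 w E (\<lambda>_. 0 :: 'a) = 0" if "finite E" for E
    using tail_bij_nonempty[OF that] by (simp add: Phi2_def)
  hence "(\<lambda>E. Phi w E (\<lambda>_. 0 :: 'a)) ` {E. finite E} = {0}"
    by (auto simp: Phi_def Phi1_def intro!: image_eqI[of _ _ "{}"])
  thus ?thesis by (simp add: normD_def)
qed

lemma normD_uminus: "normD w (\<lambda>j. - f j) = normD w f"
  unfolding normD_def Phi_def Phi1_def Phi2_def
  by (simp add: infsum_uminus)

lemma normD_add_le:
  assumes "weight w" "f \<in> c00" "g \<in> c00"
  shows "normD w (\<lambda>j. f j + g j) \<le> normD w f + normD w g"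
proof (rule normD_le)
  fix E \<phi> assume *: "finite E" "\<phi> \<in> tail_bij E"
  have "norm (tail_sum w E \<phi> (\<lambda>j. f j + g j)) \<le> norm (tail_sum w E \<phi> f) + norm (tail_sum w E \<phi> g)"
    using * assms by (simp add: tail_sum_add norm_triangle_ineq)
  with Phi1_add_le[OF assms(1), of E f g] Phi_arrangement_le_normD[OF assms(1,2) *]
    Phi_arrangement_le_normD[OF assms(1,3) *]
  show "Phi1 w E (\<lambda>j. f j + g j) + norm (tail_sum w E \<phi> (\<lambda>j. f j + g j)) \<le> normD w f + normD w g"
    by linarith
qed

lemma normD_diff_commute: "normD w (\<lambda>j. f j - g j) = normD w (\<lambda>j. g j - f j)"
  using normD_uminus[of w "\<lambda>j. f j - g j"] by simp

lemma normD_triangle: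
  assumes "weight w" "f \<in> c00" "g \<in> c00" "h \<in> c00"
  shows "normD w (\<lambda>j. f j - h j) \<le> normD w (\<lambda>j. f j - g j) + normD w (\<lambda>j. g j - h j)"
  using normD_add_le[of w "\<lambda>j. f j - g j" "\<lambda>j. g j - h j"] assms by simp

lemma abs_normD_diff_le:
  assumes "weight w" "f \<in> c00" "g \<in> c00"
  shows "\<bar>normD w f - normD w g\<bar> \<le> normD w (\<lambda>j. f j - g j)"
  using normD_triangle[OF assms(1), of f g "\<lambda>_. 0"] normD_triangle[OF assms(1), of g f "\<lambda>_. 0"]
    assms normD_diff_commute[of w f g] by simp

text \<open>Taking \<open>E\<close> to be the support, where the averages of the weight are at least \<open>c\<close>, makes the norm
  equivalent to the \<open>\<ell>\<^sub>1\<close> norm. The \<open>\<ell>\<^sub>1\<close> norm does not increase under projections, so these are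
  bounded by a constant that does not depend on the set.\<close>

lemma l1_le_normD:
  assumes "weight w" "f \<in> c00" and c: "\<And>j. c \<le> w j"
  shows "c * l1 f \<le> normD w f"
proof -
  let ?F = "{j. f j \<noteq> 0}"
  have F: "finite ?F" using assms by (simp add: c00_def)
  obtain \<phi> where \<phi>: "\<phi> \<in> tail_bij ?F" using tail_bij_nonempty[OF F] by auto
  have "c * l1 f \<le> Phi1 w ?F f"
  proof (cases "?F = {}")
    case False
    hence "card ?F > 0" using F by (simp add: card_gt_0_iff)
    moreover have "c * real (card ?F) \<le> wsum w (card ?F)"
      unfolding wsum_def using sum_bounded_below[of "{..<card ?F}" c w] c by (simp add: mult.commute)
    ultimately have "c \<le> wsum w (card ?F) / real (card ?F)" by (simp add: field_simps)
    thus ?thesis unfolding Phi1_def l1_def by (rule mult_right_mono) (simp add: sum_nonneg)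
  qed (simp add: l1_def Phi1_def)
  also have "\<dots> \<le> normD w f"
    using Phi_arrangement_le_normD[OF assms(1,2) F \<phi>] norm_ge_zero[of "tail_sum w ?F \<phi> f"] by linarith
  finally show ?thesis .
qed

lemma normD_proj_le:
  assumes "weight w" "f \<in> c00" "0 < c" "\<And>j. c \<le> w j"
  shows "normD w (proj A f) \<le> inverse c * normD w f"
proof -
  have "normD w (proj A f) \<le> l1 f"
    using normD_le_l1[OF assms(1) c00_proj[OF assms(2)]] l1_proj_le[OF assms(2)] by (rule order_trans)
  moreover have "c * l1 f \<le> normD w f" by (rule l1_le_normD) (use assms in auto)
  hence "l1 f \<le> inverse c * normD w f" using \<open>0 < c\<close> by (simp add: field_simps)
  ultimately show ?thesis by linarith
qed

section \<open>Reduction to finitely supported sequences\<close>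

lemma D_Cauchy_c00: "u \<in> D_Cauchy w \<Longrightarrow> u k \<in> c00"
  by (simp add: D_Cauchy_def)

lemma D_Cauchy_eventually:
  "u \<in> D_Cauchy w \<Longrightarrow> 0 < e \<Longrightarrow> \<exists>N. \<forall>k\<ge>N. \<forall>l\<ge>N. normD w (\<lambda>j. u k j - u l j) < e"
  by (simp add: D_Cauchy_def)

lemma const_in_D_Cauchy: "f \<in> c00 \<Longrightarrow> (\<lambda>_. f) \<in> D_Cauchy w"
  by (simp add: D_Cauchy_def)

lemma equiv_D_rel:
  assumes w: "weight w"
  shows "equiv (D_Cauchy w) (D_rel w :: ((nat \<Rightarrow> nat \<Rightarrow> 'a::real_normed_field) \<times> _) set)"
    (is "equiv _ ?R")
proof (rule equivI)
  show "?R \<subseteq> D_Cauchy w \<times> D_Cauchy w" by (auto simp: D_rel_def)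
  show "refl_on (D_Cauchy w) ?R" by (auto simp: D_rel_def refl_on_def)
  show "sym ?R"
  proof (rule symI)
    fix u v :: "nat \<Rightarrow> nat \<Rightarrow> 'a"
    assume "(u, v) \<in> D_rel w"
    thus "(v, u) \<in> D_rel w"
      using normD_diff_commute[of w "u _" "v _"] by (simp add: D_rel_def)
  qed
  show "trans ?R"
  proof (rule transI)
    fix u v x :: "nat \<Rightarrow> nat \<Rightarrow> 'a"
    assume "(u, v) \<in> D_rel w" "(v, x) \<in> D_rel w"
    hence *: "u \<in> D_Cauchy w" "v \<in> D_Cauchy w" "x \<in> D_Cauchy w"
      "(\<lambda>k. normD w (\<lambda>j. u k j - v k j)) \<longlonglongrightarrow> 0" "(\<lambda>k. normD w (\<lambda>j. v k j - x k j)) \<longlonglongrightarrow> 0"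
      by (auto simp: D_rel_def)
    have "(\<lambda>k. normD w (\<lambda>j. u k j - x k j)) \<longlonglongrightarrow> 0"
    proof (rule tendsto_sandwich[where f = "\<lambda>_. 0"])
      show "(\<lambda>k. normD w (\<lambda>j. u k j - v k j) + normD w (\<lambda>j. v k j - x k j)) \<longlonglongrightarrow> 0"
        using tendsto_add[OF *(4,5)] by simp
      show "\<forall>\<^sub>F k in sequentially. normD w (\<lambda>j. u k j - x k j) \<le>
          normD w (\<lambda>j. u k j - v k j) + normD w (\<lambda>j. v k j - x k j)"
        using * w by (intro always_eventually allI normD_triangle) (auto simp: D_Cauchy_def)
      show "\<forall>\<^sub>F k in sequentially. 0 \<le> normD w (\<lambda>j. u k j - x k j)"
        using * w by (intro always_eventually allI normD_nonneg c00_diff) (auto simp: D_Cauchy_def)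
    qed auto
    with * show "(u, x) \<in> D_rel w" by (simp add: D_rel_def)
  qed
qed

text \<open>The norms along a Cauchy sequence form a real Cauchy sequence, and equivalent sequences have the
  same limit. This turns the definite description into a limit.\<close>

lemma D_norm_class:
  assumes w: "weight w" and u: "u \<in> D_Cauchy w"
  shows "(\<lambda>k. normD w (u k)) \<longlonglongrightarrow> D_norm w (D_rel w `` {u})"
proof -
  have "Cauchy (\<lambda>k. normD w (u k))"
  proof (rule metric_CauchyI)
    fix e :: real assume "0 < e"
    then obtain N where N: "\<And>k l. k \<ge> N \<Longrightarrow> l \<ge> N \<Longrightarrow> normD w (\<lambda>j. u k j - u l j) < e"
      using D_Cauchy_eventually[OF u] by metis
    have "dist (normD w (u k)) (normD w (u l)) < e" if "k \<ge> N" "l \<ge> N" for k l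
      using abs_normD_diff_le[OF w D_Cauchy_c00[OF u] D_Cauchy_c00[OF u], of k l] N[OF that]
      by (simp add: dist_real_def)
    thus "\<exists>N. \<forall>k\<ge>N. \<forall>l\<ge>N. dist (normD w (u k)) (normD w (u l)) < e" by blast
  qed
  then obtain r where r: "(\<lambda>k. normD w (u k)) \<longlonglongrightarrow> r"
    using Cauchy_convergent convergent_def by blast
  have same: "(\<lambda>k. normD w (v k)) \<longlonglongrightarrow> r" if "(u, v) \<in> D_rel w" for v
  proof -
    have v: "v \<in> D_Cauchy w" and lim: "(\<lambda>k. normD w (\<lambda>j. u k j - v k j)) \<longlonglongrightarrow> 0"
      using that by (auto simp: D_rel_def)
    have "(\<lambda>k. normD w (u k) - normD w (v k)) \<longlonglongrightarrow> 0"
      by (rule Lim_null_comparison[OF _ lim])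
         (use abs_normD_diff_le[OF w D_Cauchy_c00[OF u] D_Cauchy_c00[OF v]] in auto)
    from tendsto_diff[OF r this] show ?thesis by simp
  qed
  have "u \<in> D_rel w `` {u}"
    using equiv_class_self[OF equiv_D_rel[OF w] u] .
  hence "D_norm w (D_rel w `` {u}) = r"
    unfolding D_norm_def
    by (intro the_equality) (use same r LIMSEQ_unique in \<open>blast+\<close>)
  with r show ?thesis by simp
qed

lemma D_norm_const:
  assumes "weight w" "f \<in> c00"
  shows "D_norm w (D_rel w `` {\<lambda>_. f}) = normD w f"
  using D_norm_class[OF assms(1) const_in_D_Cauchy[OF assms(2)]] LIMSEQ_const_iff by metis

lemma proj_diff: "proj A (\<lambda>j. f j - g j) = (\<lambda>j. proj A f j - proj A g j)"
  by (auto simp: proj_def)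

locale weight_bounded_below =
  fixes w :: "nat \<Rightarrow> real" and c :: real
  assumes weight: "weight w" and c_pos: "0 < c" and c_le: "c \<le> w j"
begin

lemma normD_proj_diff_le:
  assumes "f \<in> c00" "g \<in> c00"
  shows "normD w (\<lambda>j. proj A f j - proj A g j) \<le> inverse c * normD w (\<lambda>j. f j - g j)"
  using normD_proj_le[OF weight c00_diff[OF assms] c_pos c_le, of A] by (simp add: proj_diff)

lemma proj_in_D_Cauchy:
  assumes u: "u \<in> D_Cauchy w"
  shows "(\<lambda>k. proj A (u k)) \<in> D_Cauchy w"
  unfolding D_Cauchy_def
proof (intro CollectI conjI allI impI)
  show "proj A (u k) \<in> c00" for k using D_Cauchy_c00[OF u] by simp
  fix e :: real assume "0 < e"
  hence "0 < c * e" using c_pos by simp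
  then obtain N where N: "\<And>k l. k \<ge> N \<Longrightarrow> l \<ge> N \<Longrightarrow> normD w (\<lambda>j. u k j - u l j) < c * e"
    using D_Cauchy_eventually[OF u] by metis
  have "normD w (\<lambda>j. proj A (u k) j - proj A (u l) j) < e" if "k \<ge> N" "l \<ge> N" for k l
  proof -
    have "normD w (\<lambda>j. proj A (u k) j - proj A (u l) j) \<le> inverse c * normD w (\<lambda>j. u k j - u l j)"
      by (intro normD_proj_diff_le D_Cauchy_c00[OF u])
    also have "\<dots> < inverse c * (c * e)" using N[OF that] c_pos by simp
    finally show ?thesis using c_pos by (simp flip: mult.assoc)
  qed
  thus "\<exists>N. \<forall>k\<ge>N. \<forall>l\<ge>N. normD w (\<lambda>j. proj A (u k) j - proj A (u l) j) < e" by blast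
qed

text \<open>A bounded projection respects the equivalence, so the union in the definition collapses to the
  class of any representative.\<close>

lemma D_proj_class:
  fixes u :: "nat \<Rightarrow> nat \<Rightarrow> 'a::real_normed_field"
  assumes u: "u \<in> D_Cauchy w"
  shows "D_proj w A (D_rel w `` {u}) = D_rel w `` {\<lambda>k. proj A (u k)}"
  unfolding D_proj_def
proof (rule UN_equiv_class[OF equiv_D_rel[OF weight] _ u], rule congruentI)
  fix v x :: "nat \<Rightarrow> nat \<Rightarrow> 'a"
  assume "(v, x) \<in> D_rel w"
  hence *: "v \<in> D_Cauchy w" "x \<in> D_Cauchy w" "(\<lambda>k. normD w (\<lambda>j. v k j - x k j)) \<longlonglongrightarrow> 0"
    by (auto simp: D_rel_def)
  have "(\<lambda>k. normD w (\<lambda>j. proj A (v k) j - proj A (x k) j)) \<longlonglongrightarrow> 0"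
  proof (rule tendsto_sandwich[where f = "\<lambda>_. 0"])
    show "(\<lambda>k. inverse c * normD w (\<lambda>j. v k j - x k j)) \<longlonglongrightarrow> 0"
      using tendsto_mult_left[OF *(3)] by simp
    show "\<forall>\<^sub>F k in sequentially. normD w (\<lambda>j. proj A (v k) j - proj A (x k) j) \<le>
        inverse c * normD w (\<lambda>j. v k j - x k j)"
      using * by (intro always_eventually allI normD_proj_diff_le) (auto simp: D_Cauchy_def)
    show "\<forall>\<^sub>F k in sequentially. 0 \<le> normD w (\<lambda>j. proj A (v k) j - proj A (x k) j)"
      using * by (intro always_eventually allI normD_nonneg weight c00_diff c00_proj)
        (auto simp: D_Cauchy_def)
  qed auto
  with * proj_in_D_Cauchy show "D_rel w `` {\<lambda>k. proj A (v k)} = D_rel w `` {\<lambda>k. proj A (x k)}"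
    by (intro equiv_class_eq[OF equiv_D_rel[OF weight]]) (auto simp: D_rel_def)
qed

end

lemma Least_in_closed:
  fixes S :: "real set"
  assumes "closed S" "S \<noteq> {}" "bdd_below S"
  shows "(LEAST K. K \<in> S) \<in> S"
  using closed_contains_Inf[OF assms(2,3,1)] cInf_lower[OF _ assms(3)] by (rule LeastI2_order)

text \<open>Since \<open>LEAST\<close> is meaningful only where a minimum exists, the set of admissible constants is
  shown to be closed, nonempty and bounded below.\<close>

lemma (in weight_bounded_below) suppression_const_ge:
  fixes f :: "nat \<Rightarrow> 'a::real_normed_field"
  assumes f: "f \<in> c00" and A: "finite A" and r: "r * normD w f \<le> normD w (proj A f)"
    and pos: "0 < normD w f"
  shows "r \<le> suppression_const TYPE('a) w"
proof -
  define S where "S = {K. \<forall>A. finite A \<longrightarrow> (\<forall>x \<in> (D_space w :: (nat \<Rightarrow> nat \<Rightarrow> 'a) set set).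
           D_norm w (D_proj w A x) \<le> K * D_norm w x)}"
  have lower: "r \<le> K" if "K \<in> S" for K
  proof -
    have "D_rel w `` {\<lambda>_. f} \<in> D_space w"
      unfolding D_space_def by (intro quotientI const_in_D_Cauchy f)
    with that A have "D_norm w (D_proj w A (D_rel w `` {\<lambda>_. f})) \<le> K * D_norm w (D_rel w `` {\<lambda>_. f})"
      unfolding S_def by blast
    hence "normD w (proj A f) \<le> K * normD w f"
      by (simp add: D_proj_class const_in_D_Cauchy D_norm_const weight f)
    with r have "r * normD w f \<le> K * normD w f" by linarith
    with pos show ?thesis by simp
  qed
  have "inverse c \<in> S"
    unfolding S_def
  proof (intro CollectI allI impI ballI)
    fix A x assume "x \<in> (D_space w :: (nat \<Rightarrow> nat \<Rightarrow> 'a) set set)"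
    then obtain u where u: "u \<in> D_Cauchy w" and x: "x = D_rel w `` {u}"
      unfolding D_space_def by (rule quotientE)
    show "D_norm w (D_proj w A x) \<le> inverse c * D_norm w x"
      unfolding x D_proj_class[OF u]
      by (rule LIMSEQ_le[OF D_norm_class[OF weight proj_in_D_Cauchy[OF u]]
            tendsto_mult_left[OF D_norm_class[OF weight u]]])
         (use normD_proj_le[OF weight D_Cauchy_c00[OF u] c_pos c_le] in auto)
  qed
  moreover have "closed S"
    unfolding S_def Ball_def
    by (intro closed_Collect_all closed_Collect_imp closed_Collect_le continuous_intros) auto
  moreover have "bdd_below S" using lower by (rule bdd_belowI)
  ultimately have "(LEAST K. K \<in> S) \<in> S" by (intro Least_in_closed) auto
  from lower[OF this] show ?thesis by (simp add: suppression_const_def S_def)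
qed

section \<open>A vector with large unconditional part and much cancellation\<close>

text \<open>Removing the largest index compares it with the last index of the initial segment.\<close>

lemma sum_le_sum_initial:
  fixes g :: "nat \<Rightarrow> real"
  assumes "antimono g" "finite T"
  shows "(\<Sum>j\<in>T. g j) \<le> (\<Sum>j<card T. g j)"
  using assms(2)
proof (induction "card T" arbitrary: T)
  case (Suc n)
  hence "T \<noteq> {}" by auto
  define m where "m = Max T"
  have m: "m \<in> T" using Suc \<open>T \<noteq> {}\<close> by (simp add: m_def)
  have card: "card (T - {m}) = n" using Suc m by simp
  have "T \<subseteq> {..m}" using Suc by (auto simp: m_def)
  hence "card T \<le> Suc m" using card_mono[of "{..m}" T] by simp
  hence "g m \<le> g n" using Suc.hyps(2) antimonoD[OF assms(1), of n m] by simp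
  moreover have "(\<Sum>j\<in>T - {m}. g j) \<le> (\<Sum>j<n. g j)"
    using Suc.hyps(1)[of "T - {m}"] card Suc.prems by simp
  ultimately show ?case
    using sum.remove[OF Suc.prems m, of g] by (simp flip: Suc.hyps(2))
qed simp

lemma sum_inverse_sqrt_le: "(\<Sum>j<n. 1 / sqrt (real (Suc j))) \<le> 2 * sqrt (real n)"
proof (induction n)
  case (Suc n)
  define s t where "s = sqrt (real n)" and "t = sqrt (real (Suc n))"
  have st: "t\<^sup>2 = s\<^sup>2 + 1" "0 \<le> s" "0 < t" by (simp_all add: s_def t_def)
  have "2 * s * t \<le> s\<^sup>2 + t\<^sup>2" by (rule sum_squares_bound)
  hence "1 / t \<le> 2 * t - 2 * s"
    using st by (simp add: field_simps power2_eq_square)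
  thus ?case using Suc by (simp add: s_def t_def)
qed simp

text \<open>The first \<open>N\<close> coordinates carry the part to be kept. The cancelling part occupies \<open>N * q\<close>
  coordinates, and \<open>q\<close> is so large that any \<open>N\<close> of its entries have total mass at most \<open>1 / 2\<close>.\<close>

locale cancelling_vector =
  fixes N q :: nat
  assumes N_pos: "0 < N" and q_ge: "harm N * sqrt (real N) \<le> real q"
begin

definition w :: "nat \<Rightarrow> real" where
  "w j = 1 / sqrt (real (min (Suc j) N))"

definition c :: real where
  "c = 1 / sqrt (real N)"

text \<open>The size of the negative entries makes their total mass, weighted by the constant \<open>c\<close>, equal to
  half of the harmonic number: this balances the value left after cancellation against the value of
  the negative part alone.\<close>

definition b :: real where
  "b = harm N * sqrt (real N) / (2 * real N * real q)"

definition x :: "nat \<Rightarrow> real" where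
  "x j = (if j < N then w j else if j < N + N * q then - b else 0)"

abbreviation "A \<equiv> {..<N}"

abbreviation "B \<equiv> {N..<N + N * q}"

lemma w_initial: "j < N \<Longrightarrow> w j = 1 / sqrt (real (Suc j))"
  by (simp add: w_def)

lemma w_const: "N \<le> Suc j \<Longrightarrow> w j = c"
  by (simp add: w_def c_def)

lemma c_pos: "0 < c" and c_le_1: "c \<le> 1"
  using N_pos by (simp_all add: c_def)

lemma w_pos: "0 < w j"
  using N_pos by (simp add: w_def)

lemma antimono_w: "antimono w"
  unfolding w_def by (intro antimonoI divide_left_mono) (use N_pos in auto)

lemma c_le_w: "c \<le> w j"
  unfolding w_def c_def by (intro divide_left_mono) (use N_pos in auto)

lemma weight_w: "weight w"
  using antimono_w w_pos N_pos by (simp add: weight_def) (simp add: w_def)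

sublocale weight_bounded_below w c
  by unfold_locales (simp_all add: weight_w c_pos c_le_w)

lemma harm_N_pos: "0 < (harm N :: real)"
  using N_pos by (simp add: harm_pos)

lemma q_pos: "0 < q"
proof -
  have "0 < harm N * sqrt (real N)" using harm_N_pos N_pos by simp
  with q_ge have "0 < real q" by linarith
  thus ?thesis by simp
qed

lemma b_pos: "0 < b"
  using harm_N_pos N_pos q_pos by (simp add: b_def)

lemma mass_B: "c * b * real (card B) = harm N / 2"
  using N_pos q_pos by (simp add: b_def c_def field_simps)

lemma b_small: "b * real N \<le> 1 / 2"
  using N_pos q_pos q_ge by (simp add: b_def field_simps)

lemma sum_w_squared: "(\<Sum>j\<in>A. (w j)\<^sup>2) = harm N"
proof -
  have "(\<Sum>j\<in>A. (w j)\<^sup>2) = (\<Sum>j<N. inverse (real (Suc j)))"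
    by (rule sum.cong) (simp_all add: w_initial power_divide inverse_eq_divide)
  also have "\<dots> = harm N"
    unfolding harm_def by (rule sum.reindex_bij_witness[of _ "\<lambda>k. k - 1" Suc]) auto
  finally show ?thesis .
qed

text \<open>At most \<open>N\<close> weights exceed \<open>c\<close>, and these are at most \<open>1\<close>. Against entries of size \<open>b\<close>, the error term
  \<open>N\<close> is harmless.\<close>

lemma sum_w_le_count:
  assumes "finite T"
  shows "(\<Sum>j\<in>T. w j) \<le> c * real (card T) + real N"
proof -
  have "(\<Sum>j\<in>T. w j) \<le> (\<Sum>j\<in>T. c + (if j < N then 1 else 0))"
    by (rule sum_mono)
      (use w_const weight_le_1[OF weight_w] c_pos in \<open>auto simp: add_increasing less_imp_le\<close>)
  also have "\<dots> = c * real (card T) + real (card (T \<inter> A))"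
    using assms by (simp add: sum.distrib sum.If_cases lessThan_def)
  also have "card (T \<inter> A) \<le> N"
    using card_mono[of A "T \<inter> A"] by simp
  finally show ?thesis by simp
qed

lemma sum_w_le_sqrt:
  assumes "T \<subseteq> A" "card T \<le> n"
  shows "(\<Sum>j\<in>T. w j) \<le> 2 * sqrt (real (min n N))"
proof -
  have T: "finite T" "card T \<le> N" using assms(1) card_mono[OF _ assms(1)] finite_subset by auto
  have "(\<Sum>j\<in>T. w j) \<le> (\<Sum>j<card T. w j)"
    by (rule sum_le_sum_initial[OF antimono_w T(1)])
  also have "\<dots> = (\<Sum>j<card T. 1 / sqrt (real (Suc j)))"
    by (rule sum.cong) (use T in \<open>auto simp: w_initial\<close>)
  also have "\<dots> \<le> 2 * sqrt (real (card T))" by (rule sum_inverse_sqrt_le)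
  also have "\<dots> \<le> 2 * sqrt (real (min n N))" using T assms(2) by simp
  finally show ?thesis .
qed

text \<open>Past \<open>N\<close> the average weight stays within a factor of two of \<open>c\<close>, because the first \<open>N\<close> weights
  average to at most \<open>2 * c\<close>.\<close>

lemma wsum_w_le:
  assumes "0 < n"
  shows "wsum w n \<le> 2 * real n / sqrt (real (min n N))"
proof (cases "n \<le> N")
  case True
  have "wsum w n \<le> 2 * sqrt (real (min n N))"
    unfolding wsum_def by (rule sum_w_le_sqrt) (use True in auto)
  also have "\<dots> = 2 * real n / sqrt (real (min n N))"
    using True assms by (simp add: real_div_sqrt flip: times_divide_eq_right)
  finally show ?thesis .
next
  case False
  have "{..<n} = A \<union> {N..<n}" using False by auto
  hence "wsum w n = (\<Sum>j\<in>A. w j) + (\<Sum>j\<in>{N..<n}. w j)"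
    unfolding wsum_def by (simp add: sum.union_disjoint ivl_disj_int)
  also have "(\<Sum>j\<in>{N..<n}. w j) = c * (real n - real N)"
    using False by (simp add: w_const of_nat_diff)
  also have "(\<Sum>j\<in>A. w j) \<le> 2 * sqrt (real N)"
    using sum_w_le_sqrt[of A N] by simp
  also have "2 * sqrt (real N) = c * (2 * real N)"
    using N_pos by (simp add: c_def field_simps)
  also have "c * (2 * real N) + c * (real n - real N) = c * (real n + real N)"
    by (simp add: algebra_simps)
  also have "\<dots> \<le> c * (2 * real n)" using False c_pos by simp
  finally show ?thesis using False by (simp add: c_def)
qed

text \<open>On \<open>A\<close>, the average weight is \<open>O(1 / r)\<close> and the sum of entries is \<open>O(r)\<close>, where
  \<open>r\<^sup>2 = min (card E) N\<close>; so that part of the product is bounded by \<open>4\<close>. On \<open>B\<close>, the average weight acts as \<open>c\<close>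
  up to an error of mass at most \<open>1 / 2\<close>.\<close>

lemma Phi1_x_le:
  assumes "finite E"
  shows "Phi1 w E x \<le> 5 + c * b * real (card (E \<inter> B))"
proof (cases "E = {}")
  case True
  thus ?thesis by (simp add: Phi1_def)
next
  case False
  define n where "n = card E"
  define k where "k = card (E \<inter> B)"
  define r where "r = sqrt (real (min n N))"
  have n: "0 < n" using False assms by (simp add: n_def card_gt_0_iff)
  have r: "0 < r" using n N_pos by (simp add: r_def)
  have k: "k \<le> n" unfolding k_def n_def by (rule card_mono[OF assms]) auto
  have "(\<Sum>j\<in>E. norm (x j)) = (\<Sum>j\<in>(E \<inter> A) \<union> (E \<inter> B). \<bar>x j\<bar>)"
    by (rule sum.mono_neutral_cong_right) (use assms in \<open>auto simp: x_def\<close>)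
  also have "\<dots> = (\<Sum>j\<in>E \<inter> A. \<bar>x j\<bar>) + (\<Sum>j\<in>E \<inter> B. \<bar>x j\<bar>)"
    by (rule sum.union_disjoint) (use assms in auto)
  also have "(\<Sum>j\<in>E \<inter> A. \<bar>x j\<bar>) = (\<Sum>j\<in>E \<inter> A. w j)"
    by (rule sum.cong) (use w_pos in \<open>auto simp: x_def less_imp_le\<close>)
  also have "(\<Sum>j\<in>E \<inter> B. \<bar>x j\<bar>) = (\<Sum>j\<in>E \<inter> B. b)"
    by (rule sum.cong) (use b_pos in \<open>auto simp: x_def\<close>)
  also have "(\<Sum>j\<in>E \<inter> A. w j) \<le> 2 * r"
    unfolding r_def by (rule sum_w_le_sqrt) (auto simp: n_def intro: card_mono assms)
  finally have sum: "(\<Sum>j\<in>E. norm (x j)) \<le> 2 * r + b * real k" by (simp add: k_def mult.commute)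
  have avg: "wsum w n / real n \<le> 2 / r"
    using wsum_w_le[OF n] n by (simp add: r_def field_simps)
  \<comment> \<open>The factor \<open>real k\<close> is kept inside, so that \<open>k \<le> n\<close> absorbs the division of \<open>N\<close> by \<open>n\<close>.\<close>
  have avg': "wsum w n / real n * real k \<le> c * real k + real N"
  proof -
    have "wsum w n \<le> c * real n + real N"
      using sum_w_le_count[of "{..<n}"] by (simp add: wsum_def)
    hence "wsum w n * real k \<le> (c * real n + real N) * real k" by (rule mult_right_mono) simp
    also have "\<dots> \<le> c * real n * real k + real N * real n"
      using k by (simp add: algebra_simps mult_left_mono)
    finally show ?thesis using n by (simp add: field_simps)
  qed
  have "Phi1 w E x \<le> wsum w n / real n * (2 * r + b * real k)"
    unfolding Phi1_def n_def[symmetric]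
    by (rule mult_left_mono[OF sum]) (simp add: wsum_nonneg weight_w)
  also have "\<dots> = wsum w n / real n * (2 * r) + b * (wsum w n / real n * real k)"
    by (simp add: algebra_simps)
  also have "wsum w n / real n * (2 * r) \<le> 2 / r * (2 * r)"
    by (rule mult_right_mono[OF avg]) (use r in simp)
  also have "b * (wsum w n / real n * real k) \<le> b * (c * real k + real N)"
    by (rule mult_left_mono[OF avg']) (use b_pos in simp)
  also have "2 / r * (2 * r) = 4" using r by simp
  also have "4 + b * (c * real k + real N) \<le> 5 + c * b * real k"
    using b_small by (simp add: algebra_simps)
  finally show ?thesis by (simp add: k_def)
qed

text \<open>Since the entries on \<open>A\<close> are themselves weights, the first bound is a rearrangement inequality
  that follows from \<open>2 u v \<le> u\<^sup>2 + v\<^sup>2\<close>. If \<open>E\<close> has at least \<open>N\<close> elements, every remaining place has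
  the weight \<open>c\<close>, and the sum \<open>O(\<surd>N)\<close> of the entries is multiplied by \<open>1 / \<surd>N\<close>.\<close>

lemma positive_part_bounds:
  assumes p: "inj_on p (- E)" "\<And>i. i \<notin> E \<Longrightarrow> card E \<le> p i"
  shows "(\<Sum>i\<in>A - E. w i * w (p i)) \<le> harm N"
    and "N \<le> card E \<Longrightarrow> (\<Sum>i\<in>A - E. w i * w (p i)) \<le> 2"
proof -
  have inj: "inj_on p (A - E)" by (rule inj_on_subset[OF p(1)]) auto
  have anti: "antimono (\<lambda>j. (w j)\<^sup>2)"
    using antimono_w w_pos by (auto intro!: antimonoI power_mono simp: antimono_def less_imp_le)
  have "(\<Sum>i\<in>A - E. w i * w (p i)) \<le> (\<Sum>i\<in>A - E. ((w i)\<^sup>2 + (w (p i))\<^sup>2) / 2)"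
  proof (rule sum_mono)
    show "w i * w (p i) \<le> ((w i)\<^sup>2 + (w (p i))\<^sup>2) / 2" for i
      using sum_squares_bound[of "w i" "w (p i)"] by simp
  qed
  also have "\<dots> = ((\<Sum>i\<in>A - E. (w i)\<^sup>2) + (\<Sum>j\<in>p ` (A - E). (w j)\<^sup>2)) / 2"
    by (simp add: sum.reindex[OF inj] sum.distrib flip: sum_divide_distrib)
  also have "(\<Sum>i\<in>A - E. (w i)\<^sup>2) \<le> harm N"
    unfolding sum_w_squared[symmetric] by (rule sum_mono2) auto
  also have "(\<Sum>j\<in>p ` (A - E). (w j)\<^sup>2) \<le> harm N"
  proof -
    have "(\<Sum>j\<in>p ` (A - E). (w j)\<^sup>2) \<le> (\<Sum>j<card (p ` (A - E)). (w j)\<^sup>2)"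
      by (rule sum_le_sum_initial[OF anti]) simp
    also have "card (p ` (A - E)) \<le> N"
      using card_image_le[of "A - E" p] card_mono[of A "A - E"] by simp
    hence "(\<Sum>j<card (p ` (A - E)). (w j)\<^sup>2) \<le> (\<Sum>j\<in>A. (w j)\<^sup>2)"
      by (intro sum_mono2) auto
    finally show ?thesis by (simp add: sum_w_squared)
  qed
  finally show "(\<Sum>i\<in>A - E. w i * w (p i)) \<le> harm N" by simp
  assume N: "N \<le> card E"
  have "(\<Sum>i\<in>A - E. w i * w (p i)) = (\<Sum>i\<in>A - E. w i) * c"
    unfolding sum_distrib_right
  proof (rule sum.cong[OF refl])
    fix i assume "i \<in> A - E"
    with p(2)[of i] N have "N \<le> Suc (p i)" by simp
    thus "w i * w (p i) = w i * c" by (simp add: w_const)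
  qed
  also have "\<dots> \<le> (2 * sqrt (real N)) * c"
    by (rule mult_right_mono)
       (use sum_w_le_sqrt[of "A - E" N] card_mono[of A "A - E"] c_pos in auto)
  also have "\<dots> = 2" using N_pos by (simp add: c_def)
  finally show "(\<Sum>i\<in>A - E. w i * w (p i)) \<le> 2" .
qed

text \<open>The entries on \<open>B\<close> are too many and too small for their arrangement to matter: they are always
  weighted by \<open>c\<close>, up to a bounded error.\<close>

lemma negative_part_bounds:
  assumes p: "inj_on p (- E)"
  shows "c * b * real (card (B - E)) \<le> b * (\<Sum>i\<in>B - E. w (p i))"
    and "b * (\<Sum>i\<in>B - E. w (p i)) \<le> c * b * real (card (B - E)) + 1 / 2"
proof -
  have inj: "inj_on p (B - E)" by (rule inj_on_subset[OF p]) auto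
  have "c * real (card (B - E)) \<le> (\<Sum>i\<in>B - E. w (p i))"
    using sum_bounded_below[of "B - E" c "\<lambda>i. w (p i)"] c_le_w by (simp add: mult.commute)
  from mult_left_mono[OF this, of b]
  show "c * b * real (card (B - E)) \<le> b * (\<Sum>i\<in>B - E. w (p i))"
    using b_pos by (simp add: algebra_simps)
  have "(\<Sum>i\<in>B - E. w (p i)) = (\<Sum>j\<in>p ` (B - E). w j)" by (simp add: sum.reindex[OF inj])
  also have "\<dots> \<le> c * real (card (B - E)) + real N"
    using sum_w_le_count[of "p ` (B - E)"] by (simp add: card_image[OF inj])
  finally have "b * (\<Sum>i\<in>B - E. w (p i)) \<le> b * (c * real (card (B - E)) + real N)"
    by (rule mult_left_mono) (use b_pos in simp)
  also have "\<dots> \<le> c * b * real (card (B - E)) + 1 / 2"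
    using b_small by (simp add: algebra_simps)
  finally show "b * (\<Sum>i\<in>B - E. w (p i)) \<le> c * b * real (card (B - E)) + 1 / 2" .
qed

text \<open>Write \<open>P\<close> and \<open>Q\<close> for the positive and the negative part of the arranged sum. If \<open>Q\<close> dominates, the
  \<open>k\<close> entries on \<open>B\<close> that \<open>E\<close> removes from \<open>Q\<close> reappear in \<open>\<Phi>\<^sub>1\<close> with the same factor \<open>c\<close>, for a
  total of about \<open>harm N / 2\<close>. If \<open>P\<close> dominates, they count twice, once in \<open>\<Phi>\<^sub>1\<close> and once as missing
  cancellation. This is affordable because \<open>P\<close> and the mass of \<open>k\<close> such entries are never both large:
  \<open>P \<le> 2\<close> when \<open>card E \<ge> N\<close>, and otherwise \<open>k \<le> N\<close>.\<close>

lemma Phi_arrangement_x_le: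
  assumes E: "finite E" and p: "inj_on p (- E)" "\<And>i. i \<notin> E \<Longrightarrow> card E \<le> p i"
  shows "Phi1 w E x + \<bar>\<Sum>i\<in>(A \<union> B) - E. x i * w (p i)\<bar> \<le> 7 + harm N / 2"
proof -
  define k where "k = card (E \<inter> B)"
  define P where "P = (\<Sum>i\<in>A - E. w i * w (p i))"
  define Q where "Q = b * (\<Sum>i\<in>B - E. w (p i))"
  have split: "(\<Sum>i\<in>(A \<union> B) - E. x i * w (p i)) = P - Q"
  proof -
    have "(\<Sum>i\<in>(A \<union> B) - E. x i * w (p i)) = (\<Sum>i\<in>(A - E) \<union> (B - E). x i * w (p i))"
      by (rule sum.cong) auto
    also have "\<dots> = (\<Sum>i\<in>A - E. x i * w (p i)) + (\<Sum>i\<in>B - E. x i * w (p i))"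
      by (rule sum.union_disjoint) auto
    also have "(\<Sum>i\<in>A - E. x i * w (p i)) = P"
      unfolding P_def by (rule sum.cong) (auto simp: x_def)
    also have "(\<Sum>i\<in>B - E. x i * w (p i)) = - Q"
      unfolding Q_def sum_distrib_left sum_negf[symmetric] by (rule sum.cong) (auto simp: x_def)
    finally show ?thesis by simp
  qed
  have k: "k \<le> card B" unfolding k_def by (rule card_mono) auto
  have "card B = k + card (B - E)"
    using card_Int_Diff[of B E] by (simp add: k_def Int_commute)
  hence "real (card B) = real k + real (card (B - E))" by (simp only: of_nat_add)
  hence rest: "real (card (B - E)) = real (card B) - real k" by linarith
  have rest': "c * b * real (card (B - E)) = harm N / 2 - c * b * real k"
    unfolding rest mass_B[symmetric] by (simp only: right_diff_distrib)
  have 1: "Phi1 w E x \<le> 5 + c * b * real k" unfolding k_def by (rule Phi1_x_le[OF E])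
  have P: "P \<le> harm N" "N \<le> card E \<Longrightarrow> P \<le> 2"
    using positive_part_bounds[OF p] unfolding P_def by simp_all
  have P0: "0 \<le> P" unfolding P_def by (simp add: sum_nonneg w_pos less_imp_le)
  have Q: "harm N / 2 - c * b * real k \<le> Q" "Q \<le> harm N / 2 - c * b * real k + 1 / 2"
    using negative_part_bounds[OF p(1)] unfolding rest' Q_def by auto
  have small: "2 * (c * b * real k) + P \<le> 2 + harm N"
  proof (cases "N \<le> card E")
    case True
    have "c * b * real k \<le> c * b * real (card B)"
      by (intro mult_left_mono of_nat_mono k) (simp add: c_pos b_pos less_imp_le)
    thus ?thesis using P(2)[OF True] by (simp only: mass_B)
  next
    case False
    have "k \<le> card E" unfolding k_def by (rule card_mono[OF E]) auto
    hence "k \<le> N" using False by simp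
    hence "c * b * real k \<le> c * (b * real N)"
      unfolding mult.assoc using c_pos b_pos by (intro mult_left_mono) auto
    also have "\<dots> \<le> 1 * (1 / 2)"
      by (rule mult_mono[OF c_le_1 b_small]) (use b_pos in auto)
    finally show ?thesis using P(1) by simp
  qed
  show ?thesis unfolding split
    using 1 P0 Q small by (simp add: abs_if)
qed

definition f :: "nat \<Rightarrow> 'a::real_normed_field" where
  "f j = of_real (x j)"

lemma support_f: "{j. (f j :: 'a::real_normed_field) \<noteq> 0} \<subseteq> A \<union> B"
  by (auto simp: f_def x_def split: if_splits)

lemma f_c00: "(f :: nat \<Rightarrow> 'a::real_normed_field) \<in> c00"
  unfolding c00_def by (auto intro: finite_subset[OF support_f])

lemma normD_f_le: "normD w (f :: nat \<Rightarrow> 'a::real_normed_field) \<le> 7 + harm N / 2"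
proof (rule normD_le)
  fix E \<phi> assume E: "finite E" and \<phi>: "\<phi> \<in> tail_bij E"
  have "tail_sum w E \<phi> (f :: nat \<Rightarrow> 'a) =
      of_real (\<Sum>i\<in>(A \<union> B) - E. x i * w (position E \<phi> i))"
    by (subst tail_sum_eq[OF \<phi> _ support_f]) (simp_all add: f_def)
  moreover have "Phi1 w E (f :: nat \<Rightarrow> 'a) = Phi1 w E x"
    by (simp add: Phi1_def f_def)
  moreover have
    "Phi1 w E x + \<bar>\<Sum>i\<in>(A \<union> B) - E. x i * w (position E \<phi> i)\<bar> \<le> 7 + harm N / 2"
    by (rule Phi_arrangement_x_le[OF E inj_on_position[OF \<phi>]]) (rule position_ge[OF \<phi>])
  ultimately show
    "Phi1 w E (f :: nat \<Rightarrow> 'a) + norm (tail_sum w E \<phi> (f :: nat \<Rightarrow> 'a)) \<le> 7 + harm N / 2"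
    by (simp only: norm_of_real)
qed

text \<open>The identity arrangement with \<open>E = {}\<close> pairs each weight with itself.\<close>

lemma normD_proj_f_ge: "harm N \<le> normD w (proj A (f :: nat \<Rightarrow> 'a::real_normed_field))"
proof -
  let ?g = "proj A (f :: nat \<Rightarrow> 'a)"
  have id: "id \<in> tail_bij {}" by (simp add: tail_bij_def atLeast_0)
  have pos: "position {} id i = i" for i
    using inv_into_f_f[of id "{0..}" i] by simp
  have "tail_sum w {} id ?g = (\<Sum>i\<in>A. ?g i * of_real (w i))"
    by (subst tail_sum_eq[OF id, of A]) (auto simp: proj_def pos)
  also have "\<dots> = of_real (\<Sum>i\<in>A. (w i)\<^sup>2)"
    unfolding of_real_sum
    by (rule sum.cong) (auto simp: proj_def f_def x_def power2_eq_square)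
  finally have "norm (tail_sum w {} id ?g) = harm N"
    using harm_N_pos by (simp add: sum_w_squared)
  with Phi_arrangement_le_normD[OF weight_w c00_proj[OF f_c00[where 'a = 'a]] _ id, of A]
    Phi1_nonneg[OF weight_w, of "{}" ?g]
  show ?thesis by simp
qed

lemma suppression_const_w_ge:
  assumes "42 \<le> (harm N :: real)"
  shows "3 / 2 \<le> suppression_const TYPE('a::real_normed_field) w"
proof (rule suppression_const_ge[OF f_c00])
  show "3 / 2 * normD w (f :: nat \<Rightarrow> 'a) \<le> normD w (proj A (f :: nat \<Rightarrow> 'a))"
    using normD_f_le[where 'a = 'a] normD_proj_f_ge[where 'a = 'a] assms by linarith
  have "harm N \<le> l1 (f :: nat \<Rightarrow> 'a)"
    using normD_proj_f_ge[where 'a = 'a] normD_le_l1[OF weight_w c00_proj[OF f_c00]] l1_proj_le[OF f_c00]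
    by (meson order_trans)
  hence "0 < l1 (f :: nat \<Rightarrow> 'a)" using harm_N_pos by linarith
  hence "0 < c * l1 (f :: nat \<Rightarrow> 'a)" using c_pos by simp
  also have "\<dots> \<le> normD w (f :: nat \<Rightarrow> 'a)" by (rule l1_le_normD[OF weight_w f_c00 c_le_w])
  finally show "0 < normD w (f :: nat \<Rightarrow> 'a)" .
qed simp

end

theorem proposition3p4:
  "(\<forall>K::real. K < 3/2 \<longrightarrow> (\<exists>w. weight w \<and> suppression_const TYPE(real) w \<ge> K)) \<and>
   (\<forall>K::real. K < 3/2 \<longrightarrow> (\<exists>w. weight w \<and> suppression_const TYPE(complex) w \<ge> K))"
proof -
  have "eventually (\<lambda>N. 42 \<le> (harm N :: real)) sequentially"
    using harm_at_top by (simp add: filterlim_at_top)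
  hence "eventually (\<lambda>N. 42 \<le> (harm N :: real) \<and> 0 < N) sequentially"
    by (intro eventually_conj eventually_gt_at_top)
  then obtain N where N: "42 \<le> (harm N :: real)" "0 < N"
    unfolding eventually_sequentially by blast
  obtain q where "harm N * sqrt (real N) \<le> real q" using real_arch_simple by blast
  with N interpret cancelling_vector N q by unfold_locales
  show ?thesis
    using weight_w suppression_const_w_ge[OF N(1), where 'a = real]
      suppression_const_w_ge[OF N(1), where 'a = complex]
    by (meson less_imp_le order_trans)
qed

end
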